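(* There exists a constant $C>1$, depending only on $n$ and $s$, such that the following holds. Let $\mu>0$ and let $F_*=\{(x_1,x')\in S: |x'|\le f(x_1)\}\in\mathcal K$ (with $f$ even and non-increasing on $[0,1/2]$) be a minimizer of $P_S$ in $\mathcal K$ under the volume constraint $|F_*|=\mu$, i.e. $P_S(F_* )\le P_S(F)$ for all $F\in\mathcal K$ with $|F|=\mu$. Then $$\frac{f(1/4)}{\mu^{\frac{1}{n-1}}}\le C\,\mu^{\frac{s}{n^2(n-1)}}.$$ Moreover, for every $\delta\in(0,1)$, if $\mu\in(0,C^{-1}\delta^{n^2/s})$ then $$\frac{|F_*\cap\{|x_1|\ge 1/4\}|}{|F_*|}\le\delta.$$
   Context: Fix $n\ge 2$ and $s\in(0,1)$. Write $x=(x_1,x')\in\mathbb R\times\mathbb R^{n-1}$, $e_1=(1,0,\dots,0)$, and let $S:=[-1/2,1/2]\times\mathbb R^{n-1}$. Define the kernel $K(x):=\sum_{k\in\mathbb Z}|x+ke_1|^{-n-s}$ (with values in $(0,+\infty]$), and for a measurable $E\subseteq\mathbb R^n$ set $P_S(E):=\int_{E\cap S}\int_{S\setminus E}K(x-y)\,dx\,dy$. The class $\mathcal K$ consists of all sets $F=\{(x_1,x')\in S: |x'|\le f(x_1)\}$ where $f:[-1/2,1/2]\to[0,+\infty]$ is even and non-increasing on $[0,1/2]$. $|\cdot|$ denotes Lebesgue measure. *)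

theory Defs
  imports "HOL-Analysis.Analysis"
begin

text \<open>Points of R^n are written x = (x1, x') :: real \<times> real^'m, with n = CARD('m) + 1 \<ge> 2.\<close>

definition dimn :: "'m::finite itself \<Rightarrow> real" where
  "dimn TYPE('m) = real (CARD('m) + 1)"

definition strip :: "(real \<times> (real^'m::finite)) set" where
  "strip = {x. \<bar>fst x\<bar> \<le> 1/2}"

definition Kern :: "real \<Rightarrow> (real \<times> (real^'m::finite)) \<Rightarrow> ennreal" where
  "Kern s x = (\<Sum>\<^sub>\<infinity>k\<in>(UNIV::int set).
      (let z = (fst x + real_of_int k, snd x) in
        if z = 0 then top else ennreal (norm z powr (- (dimn TYPE('m) + s)))))"

definition PS :: "real \<Rightarrow> (real \<times> (real^'m::finite)) set \<Rightarrow> ennreal" where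
  "PS s E = (\<integral>\<^sup>+ x \<in> E \<inter> strip. (\<integral>\<^sup>+ y \<in> strip - E. Kern s (x - y) \<partial>lebesgue) \<partial>lebesgue)"

definition admissible :: "(real \<Rightarrow> ennreal) \<Rightarrow> bool" where
  "admissible f \<longleftrightarrow> (\<forall>t. \<bar>t\<bar> \<le> 1/2 \<longrightarrow> f (- t) = f t) \<and>
     (\<forall>a b. 0 \<le> a \<longrightarrow> a \<le> b \<longrightarrow> b \<le> 1/2 \<longrightarrow> f b \<le> f a)"

definition profile_set :: "(real \<Rightarrow> ennreal) \<Rightarrow> (real \<times> (real^'m::finite)) set" where
  "profile_set f = {x \<in> strip. ennreal (norm (snd x)) \<le> f (fst x)}"

definition classK :: "(real \<times> (real^'m::finite)) set set" where
  "classK = {profile_set f | f. admissible f}"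

end

theory Submission
  imports Defs
begin

text \<open>Let \<open>h = f (1/4)\<close> and \<open>R \<sim> \<mu> powr (1/(n-1))\<close>. The volume constraint forces \<open>f \<le> R\<close> on
  \<open>[1/8, 1/2]\<close>, so the cylinder \<open>[1/8, 1/4] \<times> {|x'| \<le> h}\<close> lies in \<open>F\<close> while
  \<open>{y1 \<ge> 1/8, R < |y'| \<le> 2R}\<close> does not meet \<open>F\<close>; their interaction gives
  \<open>P_S(F) \<ge> c R^(-s) h^(n-1)\<close>. A ball of radius \<open>r \<sim> \<mu> powr (1/n)\<close> is a competitor with
  \<open>P_S \<le> C r^(n-s)\<close>. Hence \<open>h^(n-1) \<le> C \<mu> powr (1 + s/(n(n-1)))\<close>, which for small \<open>\<mu>\<close> is stronger than
  the claimed exponent \<open>1 + s/n^2\<close>.\<close>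

text \<open>The factor \<open>R powr - s\<close> is a count of scales: a point of the cylinder sees,
  within distance \<open>4 * R\<close>, a region off \<open>F\<close> of volume of order
  \<open>R powr n\<close>, and on it the kernel is at least \<open>(4 * R) powr - (n + s)\<close>.
  With \<open>h = f (1/4)\<close>, minimality then bounds \<open>h^(n-1)\<close> by a constant times
  \<open>R^s * r^(n-s)\<close>, of order \<open>\<mu>^(s/(n-1) + 1 - s/n)\<close>. The gain over the
  trivial power \<open>\<mu>\<close> comes from \<open>1/(n-1) > 1/n\<close>: the radius allowed by
  the cylinder volume and the radius of a ball scale differently. The value 1/8 stands for any fixed
  point strictly between 0 and 1/4; it leaves a cylinder of fixed length while the volume still
  controls \<open>f\<close> from there on. Periodisation acts asymmetrically. For the lower bound
  one term of the kernel is enough. The upper bound must control all translates, which is why the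
  ball has radius at most 1/4. Both final claims are read off from a single bound on
  \<open>h^(n-1)\<close>, by taking a root and by enclosing the outer part in a cylinder of radius
  \<open>h\<close>.\<close>

section \<open>Integrals of powers by the layer-cake formula\<close>

lemma nn_integral_powr_tail:
  fixes d q :: real
  assumes "0 < d" "0 < q"
  shows "(\<integral>\<^sup>+ t\<in>{d..}. ennreal (q * t powr (- q - 1)) \<partial>lborel) = ennreal (d powr - q)"
proof -
  have "(\<integral>\<^sup>+ t\<in>{d..}. ennreal (q * t powr (- q - 1)) \<partial>lborel) = ennreal (0 - (- (d powr - q)))"
  proof (rule nn_integral_FTC_atLeast)
    show "((\<lambda>t. - (t powr - q)) has_real_derivative q * t powr (- q - 1)) (at t)" if "d \<le> t" for t
      using that assms by (auto intro!: derivative_eq_intros)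
    show "((\<lambda>t. - (t powr - q)) \<longlongrightarrow> 0) at_top"
      using tendsto_neg_powr[OF _ filterlim_ident, of "- q"] assms
      by (auto intro: tendsto_minus_cancel_left[THEN iffD1])
  qed (use assms in auto)
  then show ?thesis by simp
qed

lemma nn_integral_powr_0:
  fixes a c :: real
  assumes "a > -1" "c \<ge> 0"
  shows "(\<integral>\<^sup>+ t\<in>{0..c}. ennreal (t powr a) \<partial>lborel) = ennreal (c powr (a + 1) / (a + 1))"
proof -
  have eq: "(\<lambda>t. t powr a * indicator {0..c} t) = (\<lambda>t. if t \<in> {0..c} then t powr a else 0)"
    by auto
  have "((\<lambda>t. t powr a * indicator {0..c} t) has_integral c powr (a + 1) / (a + 1)) UNIV"
    unfolding eq has_integral_restrict_UNIV by (rule has_integral_powr_from_0[OF assms])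
  then have "(\<integral>\<^sup>+ t. ennreal (t powr a * indicator {0..c} t) \<partial>lborel) = ennreal (c powr (a + 1) / (a + 1))"
    by (intro nn_integral_has_integral_lborel) auto
  then show ?thesis
    by (simp add: ennreal_mult' ennreal_indicator)
qed

text \<open>Write \<open>u x powr - q\<close> as the integral of \<open>q * t powr (- q - 1)\<close>
  over \<open>t\<close> from \<open>u x\<close> to infinity and exchange the integrals. Only volumes
  of sublevel sets remain, so the radial integrals below need no polar coordinates.\<close>

lemma nn_integral_layer_cake:
  fixes u :: "'a::euclidean_space \<Rightarrow> real"
  assumes [measurable]: "A \<in> sets borel" "u \<in> borel_measurable borel"
    and pos: "\<And>x. x \<in> A \<Longrightarrow> 0 < u x" and "0 < q"
  shows "(\<integral>\<^sup>+ x\<in>A. ennreal (u x powr - q) \<partial>lborel) =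
    (\<integral>\<^sup>+ t\<in>{0..}. ennreal (q * t powr (- q - 1)) * emeasure lborel {x\<in>A. u x \<le> t} \<partial>lborel)"
proof -
  have [measurable]: "{x\<in>A. u x \<le> t} \<in> sets borel" for t
    by simp
  have "(\<integral>\<^sup>+ x\<in>A. ennreal (u x powr - q) \<partial>lborel) =
      (\<integral>\<^sup>+ x. (\<integral>\<^sup>+ t. ennreal (q * t powr (- q - 1)) * of_bool (x \<in> A \<and> u x \<le> t) \<partial>lborel) \<partial>lborel)"
  proof (intro nn_integral_cong)
    fix x
    show "ennreal (u x powr - q) * indicator A x =
      (\<integral>\<^sup>+ t. ennreal (q * t powr (- q - 1)) * of_bool (x \<in> A \<and> u x \<le> t) \<partial>lborel)"
      using nn_integral_powr_tail[OF pos \<open>0 < q\<close>, of x]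
      by (cases "x \<in> A") (auto simp: indicator_def)
  qed
  also have "\<dots> = (\<integral>\<^sup>+ t. (\<integral>\<^sup>+ x. ennreal (q * t powr (- q - 1)) * of_bool (x \<in> A \<and> u x \<le> t) \<partial>lborel) \<partial>lborel)"
    by (rule lborel_pair.Fubini'[symmetric]) measurable
  also have "\<dots> = (\<integral>\<^sup>+ t\<in>{0..}. ennreal (q * t powr (- q - 1)) * emeasure lborel {x\<in>A. u x \<le> t} \<partial>lborel)"
  proof (intro nn_integral_cong)
    fix t :: real
    have "(\<integral>\<^sup>+ x. ennreal (q * t powr (- q - 1)) * of_bool (x \<in> A \<and> u x \<le> t) \<partial>lborel)
      = ennreal (q * t powr (- q - 1)) * (\<integral>\<^sup>+ x. indicator {x\<in>A. u x \<le> t} x \<partial>lborel)"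
      by (subst nn_integral_cmult[symmetric]) (auto intro!: nn_integral_cong simp: indicator_def)
    also have "\<dots> = ennreal (q * t powr (- q - 1)) * emeasure lborel {x\<in>A. u x \<le> t}"
      by simp
    also have "\<dots> = ennreal (q * t powr (- q - 1)) * emeasure lborel {x\<in>A. u x \<le> t} * indicator {0..} t"
    proof (cases "0 \<le> t")
      case False
      then have "{x\<in>A. u x \<le> t} = {}"
        using pos by force
      then show ?thesis
        by (simp only: emeasure_empty mult_zero_right mult_zero_left)
    qed simp
    finally show "(\<integral>\<^sup>+ x. ennreal (q * t powr (- q - 1)) * of_bool (x \<in> A \<and> u x \<le> t) \<partial>lborel)
      = ennreal (q * t powr (- q - 1)) * emeasure lborel {x\<in>A. u x \<le> t} * indicator {0..} t" .
  qed
  finally show ?thesis .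
qed

text \<open>The sublevel set is empty for \<open>t < d\<close> and lies in the ball of radius
  \<open>t\<close> otherwise. Enlarging the annulus to this ball turns the exact constant
  \<open>n / s\<close> into \<open>(n + s) / s\<close>.\<close>

lemma nn_integral_norm_powr_tail_le:
  fixes d s :: real
  defines "n \<equiv> real DIM('a::euclidean_space)"
  assumes "0 < d" "0 < s"
  shows "(\<integral>\<^sup>+ z\<in>{z::'a. d \<le> norm z}. ennreal (norm z powr - (n + s)) \<partial>lborel)
    \<le> ennreal ((n + s) / s * unit_ball_vol n * d powr - s)"
proof -
  have n: "n \<ge> 1" unfolding n_def by (simp add: Suc_leI)
  let ?w = "unit_ball_vol n"
  have w: "?w \<ge> 0" using n by simp
  have "(\<integral>\<^sup>+ z\<in>{z::'a. d \<le> norm z}. ennreal (norm z powr - (n + s)) \<partial>lborel)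
    = (\<integral>\<^sup>+ t\<in>{0..}. ennreal ((n + s) * t powr (- (n + s) - 1)) *
        emeasure lborel {z\<in>{z::'a. d \<le> norm z}. norm z \<le> t} \<partial>lborel)"
    by (rule nn_integral_layer_cake) (use assms n in auto)
  also have "\<dots> \<le> (\<integral>\<^sup>+ t. ennreal ((n + s) / s * ?w) * (ennreal (s * t powr (- s - 1)) * indicator {d..} t) \<partial>lborel)"
  proof (intro nn_integral_mono)
    fix t :: real
    show "ennreal ((n + s) * t powr (- (n + s) - 1)) * emeasure lborel {z\<in>{z::'a. d \<le> norm z}. norm z \<le> t} * indicator {0..} t
      \<le> ennreal ((n + s) / s * ?w) * (ennreal (s * t powr (- s - 1)) * indicator {d..} t)"
    proof (cases "d \<le> t")
      case False
      then have "{z\<in>{z::'a. d \<le> norm z}. norm z \<le> t} = {}"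
        by force
      then show ?thesis
        by (simp only: emeasure_empty mult_zero_right mult_zero_left zero_le)
    next
      case True
      then have t: "0 < t" using assms by simp
      have "emeasure lborel {z\<in>{z::'a. d \<le> norm z}. norm z \<le> t} \<le> emeasure lborel (cball (0::'a) t)"
        by (intro emeasure_mono) auto
      also have "\<dots> = ennreal (?w * t powr n)"
        using t by (subst emeasure_cball) (auto simp: n_def powr_realpow)
      finally have "ennreal ((n + s) * t powr (- (n + s) - 1)) * emeasure lborel {z\<in>{z::'a. d \<le> norm z}. norm z \<le> t}
         \<le> ennreal ((n + s) * t powr (- (n + s) - 1)) * ennreal (?w * t powr n)"
        by (intro mult_left_mono) auto
      also have "\<dots> = ennreal ((n + s) * ?w * (t powr (- (n + s) - 1) * t powr n))"
        using w n assms by (simp add: mult_ac flip: ennreal_mult)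
      also have "t powr (- (n + s) - 1) * t powr n = t powr (- s - 1)"
        by (simp flip: powr_add)
      also have "ennreal ((n + s) * ?w * t powr (- s - 1)) = ennreal ((n + s) / s * ?w) * ennreal (s * t powr (- s - 1))"
        using w n assms by (simp flip: ennreal_mult)
      finally show ?thesis
        using True t by simp
    qed
  qed
  also have "\<dots> = ennreal ((n + s) / s * ?w) * ennreal (d powr - s)"
    by (subst nn_integral_cmult) (use assms in \<open>auto simp: nn_integral_powr_tail\<close>)
  also have "\<dots> = ennreal ((n + s) / s * ?w * d powr - s)"
    using w n assms(2,3) by (simp flip: ennreal_mult)
  finally show ?thesis .
qed

text \<open>The shell has volume proportional to \<open>r^n - (r - t)^n\<close>, which Bernoulli's
  inequality for \<open>(1 - t / r)^n\<close> bounds linearly in \<open>t\<close>.\<close>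

lemma emeasure_ball_shell_le:
  fixes r t :: real
  defines "n \<equiv> real DIM('a::euclidean_space)"
  assumes "0 < t" "t \<le> r"
  shows "emeasure lborel {x\<in>ball (0::'a) r. r - norm x \<le> t} \<le> ennreal (unit_ball_vol n * n * r powr (n - 1) * t)"
proof -
  have n: "n \<ge> 1" unfolding n_def by (simp add: Suc_leI)
  have r: "r > 0" using assms by simp
  have w: "unit_ball_vol n \<ge> 0" using n by simp
  have "{x\<in>ball (0::'a) r. r - norm x \<le> t} \<subseteq> ball 0 r - ball 0 (r - t)"
    by auto
  then have "emeasure lborel {x\<in>ball (0::'a) r. r - norm x \<le> t} \<le> emeasure lborel (ball (0::'a) r - ball 0 (r - t))"
    by (intro emeasure_mono) auto
  also have "\<dots> = emeasure lborel (ball (0::'a) r) - emeasure lborel (ball (0::'a) (r - t))"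
    using assms by (intro emeasure_Diff) (auto simp: emeasure_ball)
  also have "\<dots> = ennreal (unit_ball_vol n * (r ^ DIM('a) - (r - t) ^ DIM('a)))"
    using assms w by (simp add: emeasure_ball n_def algebra_simps ennreal_minus)
  also have "\<dots> \<le> ennreal (unit_ball_vol n * (n * r powr (n - 1) * t))"
  proof (intro ennreal_leI mult_left_mono w)
    have "1 + n * (- (t / r)) \<le> (1 + - (t / r)) ^ DIM('a)"
      unfolding n_def using assms by (intro Bernoulli_inequality) auto
    then have "r ^ DIM('a) * (1 + n * (- (t / r))) \<le> r ^ DIM('a) * (1 + - (t / r)) ^ DIM('a)"
      using r by (intro mult_left_mono) auto
    also have "\<dots> = (r - t) ^ DIM('a)"
      using r by (simp add: field_simps flip: power_mult_distrib)
    finally have "r ^ DIM('a) - (r - t) ^ DIM('a) \<le> n * (r ^ DIM('a) / r) * t"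
      using r by (simp add: algebra_simps)
    also have "r ^ DIM('a) / r = r powr (n - 1)"
      using r by (simp add: n_def powr_diff powr_realpow)
    finally show "r ^ DIM('a) - (r - t) ^ DIM('a) \<le> n * r powr (n - 1) * t" .
  qed
  finally show ?thesis by (simp add: mult_ac)
qed

text \<open>Levels \<open>t \<le> r\<close> use the linear shell bound and leave the integral of
  \<open>t powr - s\<close>, finite because \<open>s < 1\<close>; levels \<open>t \<ge> r\<close>
  use the volume of the whole ball. The two summands of the constant come from these two
  ranges.\<close>

lemma nn_integral_ball_dist_powr_le:
  fixes r s :: real
  defines "n \<equiv> real DIM('a::euclidean_space)"
  assumes "0 < r" "0 < s" "s < 1"
  shows "(\<integral>\<^sup>+ x\<in>ball (0::'a) r. ennreal ((r - norm x) powr - s) \<partial>lborel)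
    \<le> ennreal ((n * s / (1 - s) + 1) * unit_ball_vol n * r powr (n - s))"
proof -
  have n: "n \<ge> 1" unfolding n_def by (simp add: Suc_leI)
  let ?w = "unit_ball_vol n"
  have w: "?w \<ge> 0" using n by simp
  let ?c1 = "?w * n * r powr (n - 1) * s" and ?c2 = "?w * r powr n"
  have c: "?c1 \<ge> 0" "?c2 \<ge> 0" using w n assms by auto
  have "(\<integral>\<^sup>+ x\<in>ball (0::'a) r. ennreal ((r - norm x) powr - s) \<partial>lborel)
    = (\<integral>\<^sup>+ t\<in>{0..}. ennreal (s * t powr (- s - 1)) * emeasure lborel {x\<in>ball (0::'a) r. r - norm x \<le> t} \<partial>lborel)"
    by (rule nn_integral_layer_cake) (use assms in auto)
  also have "\<dots> \<le> (\<integral>\<^sup>+ t. ennreal ?c1 * (ennreal (t powr - s) * indicator {0..r} t)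
      + ennreal ?c2 * (ennreal (s * t powr (- s - 1)) * indicator {r..} t) \<partial>lborel)"
  proof (intro nn_integral_mono)
    fix t :: real
    let ?A = "{x\<in>ball (0::'a) r. r - norm x \<le> t}"
    consider "t \<le> 0" | "0 < t" "t \<le> r" | "r \<le> t" "0 < t" using assms by linarith
    then show "ennreal (s * t powr (- s - 1)) * emeasure lborel ?A * indicator {0..} t
      \<le> ennreal ?c1 * (ennreal (t powr - s) * indicator {0..r} t)
      + ennreal ?c2 * (ennreal (s * t powr (- s - 1)) * indicator {r..} t)"
    proof cases
      case 1
      then have "?A = {}" by auto
      then show ?thesis
        by (simp only: emeasure_empty mult_zero_right mult_zero_left zero_le)
    next
      case 2
      have "ennreal (s * t powr (- s - 1)) * emeasure lborel ?A
        \<le> ennreal (s * t powr (- s - 1)) * ennreal (?w * n * r powr (n - 1) * t)"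
        using emeasure_ball_shell_le[where 'a='a, OF 2] by (intro mult_left_mono) (auto simp: n_def)
      also have "\<dots> = ennreal (?c1 * (t powr (- s - 1) * t powr 1))"
        using w n assms 2 by (simp add: mult_ac flip: ennreal_mult)
      also have "t powr (- s - 1) * t powr 1 = t powr - s"
        by (simp only: flip: powr_add) simp
      also have "ennreal (?c1 * t powr - s) = ennreal ?c1 * ennreal (t powr - s)"
        using c by (simp add: ennreal_mult)
      finally show ?thesis
        using 2 by (auto intro: add_increasing2)
    next
      case 3
      have "emeasure lborel ?A \<le> emeasure lborel (ball (0::'a) r)"
        by (intro emeasure_mono) auto
      also have "\<dots> = ennreal ?c2"
        using assms by (simp add: emeasure_ball n_def powr_realpow)
      finally have "ennreal (s * t powr (- s - 1)) * emeasure lborel ?A \<le> ennreal ?c2 * ennreal (s * t powr (- s - 1))"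
        by (subst mult.commute) (intro mult_right_mono, auto)
      then show ?thesis
        using 3 by (auto intro: add_increasing)
    qed
  qed
  also have "\<dots> = ennreal ?c1 * ennreal (r powr (1 - s) / (1 - s)) + ennreal ?c2 * ennreal (r powr - s)"
    using assms nn_integral_powr_0[of "- s" r]
    by (simp add: nn_integral_add nn_integral_cmult nn_integral_powr_tail)
  also have "\<dots> = ennreal (?w * n * s / (1 - s) * (r powr (n - 1) * r powr (1 - s)) + ?w * (r powr n * r powr - s))"
    using c assms w n by (simp add: mult_ac flip: ennreal_mult ennreal_plus)
  also have "?w * n * s / (1 - s) * (r powr (n - 1) * r powr (1 - s)) + ?w * (r powr n * r powr - s)
     = (n * s / (1 - s) + 1) * ?w * r powr (n - s)"
    by (simp add: algebra_simps flip: powr_add)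
  finally show ?thesis .
qed

section \<open>The strip and the periodised kernel\<close>

lemma nn_integral_lborel_translate:
  fixes g :: "'a::euclidean_space \<Rightarrow> ennreal"
  assumes "g \<in> borel_measurable borel"
  shows "(\<integral>\<^sup>+ y. g y \<partial>lborel) = (\<integral>\<^sup>+ y. g (c + y) \<partial>lborel)"
  using assms by (subst lborel_distr_plus[of c, symmetric]) (simp add: nn_integral_distr)

lemma emeasure_lborel_Times:
  fixes A :: "'a::euclidean_space set" and B :: "'b::euclidean_space set"
  assumes "A \<in> sets borel" "B \<in> sets borel"
  shows "emeasure lborel (A \<times> B) = emeasure lborel A * emeasure lborel B"
  using assms by (simp add: lborel.emeasure_pair_measure_Times flip: lborel_prod)

lemma strip_borel [measurable]: "strip \<in> sets borel"
  unfolding strip_def by (intro borel_closed closed_Collect_le continuous_intros)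

text \<open>Keep only the term \<open>k = 0\<close> of a sum of nonnegative terms.\<close>

lemma Kern_ge:
  fixes z :: "real \<times> (real^'m::finite)"
  assumes "z \<noteq> 0"
  shows "ennreal (norm z powr - (dimn TYPE('m) + s)) \<le> Kern s z"
proof -
  define g where "g k = (let z = (fst z + real_of_int k, snd z) in
        if z = 0 then top else ennreal (norm z powr (- (dimn TYPE('m) + s))))" for k
  have "Kern s z = (SUP F\<in>{F. finite F \<and> F \<subseteq> UNIV}. sum g F)"
    unfolding Kern_def g_def by (rule nonneg_infsum_complete) simp
  also have "\<dots> \<ge> sum g {0}"
    by (rule SUP_upper) simp
  finally show ?thesis
    using assms by (simp add: g_def)
qed

text \<open>A closed interval of length 1 holds at most two points of a translate of the integers,
  and two only when they are its endpoints. The first candidate \<open>?c\<close> is the least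
  \<open>k\<close> with \<open>t + k \<ge> - 1/2\<close>.\<close>

lemma card_int_translates_le_2: "card {k\<in>A. \<bar>t + real_of_int k\<bar> \<le> 1/2} \<le> 2"
proof -
  let ?c = "\<lceil>- 1/2 - t\<rceil>"
  have "{k\<in>A. \<bar>t + real_of_int k\<bar> \<le> 1/2} \<subseteq> {?c, ?c + 1}"
  proof
    fix k assume "k \<in> {k\<in>A. \<bar>t + real_of_int k\<bar> \<le> 1/2}"
    then have "\<bar>t + real_of_int k\<bar> \<le> 1/2" by blast
    then have "k = ?c \<or> k = ?c + 1" by linarith
    then show "k \<in> {?c, ?c + 1}" by blast
  qed
  then have "card {k\<in>A. \<bar>t + real_of_int k\<bar> \<le> 1/2} \<le> card {?c, ?c + 1}"
    by (intro card_mono) auto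
  then show ?thesis by simp
qed

text \<open>Unfolding the periodised kernel turns the strip into the whole space; the factor 2 absorbs
  the overlap of the closed translated strips.\<close>

lemma nn_integral_strip_Kern_le:
  fixes x :: "real \<times> (real^'m::finite)"
  assumes "norm x < r" "r \<le> 1/4"
  shows "(\<integral>\<^sup>+ y\<in>strip - cball 0 r. Kern s (x - y) \<partial>lborel)
    \<le> 2 * (\<integral>\<^sup>+ w\<in>- cball 0 r. ennreal (norm (x - w) powr - (dimn TYPE('m) + s)) \<partial>lborel)"
proof -
  define g where "g z = (if z = 0 then top else ennreal (norm z powr - (dimn TYPE('m) + s)))"
    for z :: "real \<times> (real^'m)"
  have [measurable]: "g \<in> borel_measurable borel"
    unfolding g_def by measurable
  define e where "e k = (real_of_int k, 0 :: real^'m)" for k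
  define D where "D = strip - cball (0 :: real \<times> (real^'m)) r"
  have [measurable]: "D \<in> sets borel"
    unfolding D_def by measurable
  have shift: "g ((fst z + real_of_int k, snd z)) = g (z + e k)" for z k
    by (cases z) (simp add: e_def)
  \<comment> \<open>The windows \<open>{- int N..int N}\<close> increase with \<open>N\<close>, so
    the sum over all integers becomes the limit of a monotone sequence and monotone convergence
    applies.\<close>
  have Kern_SUP: "Kern s z = (SUP N::nat. \<Sum>k\<in>{- int N..int N}. g (z + e k))" for z
  proof -
    have "Kern s z = (\<Sum>\<^sub>\<infinity>k. g (z + e k))"
      unfolding Kern_def Let_def shift[symmetric] by (simp add: g_def)
    also have "\<dots> = (SUP F\<in>{F. finite F \<and> F \<subseteq> UNIV}. \<Sum>k\<in>F. g (z + e k))"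
      by (rule nonneg_infsum_complete) simp
    also have "\<dots> = (SUP N::nat. \<Sum>k\<in>{- int N..int N}. g (z + e k))"
    proof (rule antisym)
      show "(SUP F\<in>{F. finite F \<and> F \<subseteq> UNIV}. \<Sum>k\<in>F. g (z + e k)) \<le> (SUP N::nat. \<Sum>k\<in>{- int N..int N}. g (z + e k))"
      proof (rule SUP_least)
        fix F :: "int set" assume "F \<in> {F. finite F \<and> F \<subseteq> UNIV}"
        then have F: "finite F" by simp
        define N where "N = (\<Sum>k\<in>F. nat \<bar>k\<bar>)"
        have "F \<subseteq> {- int N..int N}"
        proof
          fix k assume "k \<in> F"
          then have "nat \<bar>k\<bar> \<le> N" unfolding N_def using F by (intro member_le_sum) auto
          then show "k \<in> {- int N..int N}" by auto
        qed
        then have "(\<Sum>k\<in>F. g (z + e k)) \<le> (\<Sum>k\<in>{- int N..int N}. g (z + e k))"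
          by (intro sum_mono2) auto
        also have "\<dots> \<le> (SUP N::nat. \<Sum>k\<in>{- int N..int N}. g (z + e k))"
          by (rule SUP_upper) simp
        finally show "(\<Sum>k\<in>F. g (z + e k)) \<le> \<dots>" .
      qed
      show "(SUP N::nat. \<Sum>k\<in>{- int N..int N}. g (z + e k)) \<le> (SUP F\<in>{F. finite F \<and> F \<subseteq> UNIV}. \<Sum>k\<in>F. g (z + e k))"
        by (intro SUP_least SUP_upper) simp
    qed
    finally show ?thesis .
  qed
  have "(\<integral>\<^sup>+ y\<in>D. Kern s (x - y) \<partial>lborel) =
      (\<integral>\<^sup>+ y. (SUP N::nat. (\<Sum>k\<in>{- int N..int N}. g (x - y + e k)) * indicator D y) \<partial>lborel)"
    unfolding Kern_SUP by (simp add: SUP_mult_right_ennreal)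
  also have "\<dots> = (SUP N::nat. \<integral>\<^sup>+ y. (\<Sum>k\<in>{- int N..int N}. g (x - y + e k)) * indicator D y \<partial>lborel)"
    by (intro nn_integral_monotone_convergence_SUP incseq_SucI le_funI mult_right_mono sum_mono2) auto
  also have "\<dots> \<le> (\<integral>\<^sup>+ w. 2 * (ennreal (norm (x - w) powr - (dimn TYPE('m) + s)) * indicator (- cball 0 r) w) \<partial>lborel)"
  proof (rule SUP_least)
    fix N :: nat
    let ?A = "{- int N..int N}"
    have "(\<integral>\<^sup>+ y. (\<Sum>k\<in>?A. g (x - y + e k)) * indicator D y \<partial>lborel)
       = (\<Sum>k\<in>?A. \<integral>\<^sup>+ y. g (x - y + e k) * indicator D y \<partial>lborel)"
      unfolding sum_distrib_right by (rule nn_integral_sum) measurable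
    \<comment> \<open>The substitution \<open>y = e k + w\<close> moves the shift from the kernel to
      the indicator, so that summing over \<open>k\<close> only counts the translates of
      \<open>w\<close> that lie in \<open>D\<close>.\<close>
    also have "\<dots> = (\<Sum>k\<in>?A. \<integral>\<^sup>+ w. g (x - w) * indicator D (e k + w) \<partial>lborel)"
    proof (intro sum.cong refl)
      fix k
      show "(\<integral>\<^sup>+ y. g (x - y + e k) * indicator D y \<partial>lborel) = (\<integral>\<^sup>+ w. g (x - w) * indicator D (e k + w) \<partial>lborel)"
        by (subst nn_integral_lborel_translate[where c="e k"]) (auto intro!: nn_integral_cong simp: algebra_simps)
    qed
    also have "\<dots> = (\<integral>\<^sup>+ w. g (x - w) * (\<Sum>k\<in>?A. indicator D (e k + w)) \<partial>lborel)"
      unfolding sum_distrib_left by (rule nn_integral_sum[symmetric]) measurable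
    also have "\<dots> \<le> (\<integral>\<^sup>+ w. 2 * (ennreal (norm (x - w) powr - (dimn TYPE('m) + s)) * indicator (- cball 0 r) w) \<partial>lborel)"
    proof (intro nn_integral_mono)
      fix w :: "real \<times> (real^'m)"
      obtain a b where w: "w = (a, b)" by (cases w)
      have S: "(\<Sum>k\<in>?A. indicator D (e k + w)) = (of_nat (card {k\<in>?A. e k + w \<in> D}) :: ennreal)"
        by (simp add: indicator_def of_bool_def sum.If_cases Int_def)
      show "g (x - w) * (\<Sum>k\<in>?A. indicator D (e k + w))
        \<le> 2 * (ennreal (norm (x - w) powr - (dimn TYPE('m) + s)) * indicator (- cball 0 r) w)"
      proof (cases "w \<in> cball 0 r")
        case True
        \<comment> \<open>Here \<open>r \<le> 1/4\<close> enters: a nonzero integer shift pushes the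
          ball out of the strip, and the unshifted ball has been removed from
          \<open>D\<close>.\<close>
        have "e k + w \<notin> D" for k
        proof
          assume k: "e k + w \<in> D"
          have "\<bar>a\<bar> \<le> 1/4"
            using True assms norm_fst_le[of a b] by (simp add: w)
          moreover have "\<bar>real_of_int k + a\<bar> \<le> 1/2"
            using k by (simp add: D_def strip_def e_def w)
          ultimately have "\<bar>real_of_int k\<bar> < 1" by linarith
          then have "k = 0" by linarith
          then show False
            using k True by (simp add: D_def e_def w zero_prod_def)
        qed
        then have "(\<Sum>k\<in>?A. indicator D (e k + w)) = (0::ennreal)"
          by simp
        then show ?thesis by (simp only: mult_zero_right zero_le)
      next
        case False
        have "{k\<in>?A. e k + w \<in> D} \<subseteq> {k\<in>?A. \<bar>a + real_of_int k\<bar> \<le> 1/2}"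
          by (auto simp: D_def strip_def e_def w add.commute)
        then have "card {k\<in>?A. e k + w \<in> D} \<le> card {k\<in>?A. \<bar>a + real_of_int k\<bar> \<le> 1/2}"
          by (intro card_mono finite_subset[of "{k\<in>?A. _ k}" ?A]) auto
        then have "card {k\<in>?A. e k + w \<in> D} \<le> 2"
          using card_int_translates_le_2[of ?A a] by linarith
        then have "(\<Sum>k\<in>?A. indicator D (e k + w)) \<le> (of_nat 2 :: ennreal)"
          unfolding S by (subst of_nat_le_iff)
        then have "g (x - w) * (\<Sum>k\<in>?A. indicator D (e k + w)) \<le> g (x - w) * 2"
          by (intro mult_left_mono) auto
        moreover have "x \<noteq> w" using False assms by auto
        ultimately show ?thesis
          using False by (simp add: g_def mult.commute)
      qed
    qed
    finally show "(\<integral>\<^sup>+ y. (\<Sum>k\<in>?A. g (x - y + e k)) * indicator D y \<partial>lborel) \<le> \<dots>" .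
  qed
  also have "\<dots> = 2 * (\<integral>\<^sup>+ w\<in>- cball 0 r. ennreal (norm (x - w) powr - (dimn TYPE('m) + s)) \<partial>lborel)"
    by (rule nn_integral_cmult) measurable
  finally show ?thesis unfolding D_def .
qed

lemma dimn_eq_DIM: "dimn TYPE('m::finite) = real DIM(real \<times> (real^'m))"
  by (simp add: dimn_def)

text \<open>By the triangle inequality every point outside the ball has distance at least
  \<open>r - norm x\<close> from \<open>x\<close>, so the tail integral centred at \<open>x\<close>
  bounds the unfolded one.\<close>

lemma nn_integral_strip_Kern_le_dist:
  fixes x :: "real \<times> (real^'m::finite)"
  defines "n \<equiv> dimn TYPE('m)"
  assumes "norm x < r" "r \<le> 1/4" "0 < s"
  shows "(\<integral>\<^sup>+ y\<in>strip - cball 0 r. Kern s (x - y) \<partial>lborel)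
    \<le> ennreal (2 * ((n + s) / s * unit_ball_vol n) * (r - norm x) powr - s)"
proof -
  have n: "n \<ge> 1" unfolding n_def dimn_def by simp
  have "(\<integral>\<^sup>+ w\<in>- cball 0 r. ennreal (norm (x - w) powr - (n + s)) \<partial>lborel)
     = (\<integral>\<^sup>+ z. ennreal (norm z powr - (n + s)) * indicator (- cball 0 r) (x + z) \<partial>lborel)"
    by (subst nn_integral_lborel_translate[where c=x]) auto
  also have "\<dots> \<le> (\<integral>\<^sup>+ z\<in>{z :: real \<times> (real^'m). r - norm x \<le> norm z}. ennreal (norm z powr - (n + s)) \<partial>lborel)"
  proof (intro nn_integral_mono mult_left_mono)
    fix z
    show "indicator (- cball 0 r) (x + z) \<le> (indicator {z. r - norm x \<le> norm z} z :: ennreal)"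
      using norm_triangle_ineq[of x z] by (auto simp: indicator_def)
  qed simp
  also have "\<dots> \<le> ennreal ((n + s) / s * unit_ball_vol n * (r - norm x) powr - s)"
    unfolding n_def dimn_eq_DIM using assms by (intro nn_integral_norm_powr_tail_le) auto
  finally have *: "(\<integral>\<^sup>+ w\<in>- cball 0 r. ennreal (norm (x - w) powr - (n + s)) \<partial>lborel)
     \<le> ennreal ((n + s) / s * unit_ball_vol n * (r - norm x) powr - s)" .
  have "(\<integral>\<^sup>+ y\<in>strip - cball 0 r. Kern s (x - y) \<partial>lborel)
    \<le> 2 * ennreal ((n + s) / s * unit_ball_vol n * (r - norm x) powr - s)"
    using * unfolding n_def
    by (intro order_trans[OF nn_integral_strip_Kern_le[OF assms(2,3)] mult_left_mono]) auto
  also have "\<dots> = ennreal (2 * ((n + s) / s * unit_ball_vol n) * (r - norm x) powr - s)"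
    using n \<open>0 < s\<close> by (subst ennreal_numeral[symmetric], subst ennreal_mult[symmetric]) (auto simp: mult.assoc)
  finally show ?thesis .
qed

section \<open>The ball as a competitor\<close>

text \<open>Outside \<open>[-r, r]\<close> the square root is negative and \<open>ennreal\<close> truncates it to \<open>0\<close>, so the profile
  set is the closed ball together with a null segment of the axis.\<close>

definition ball_profile :: "real \<Rightarrow> real \<Rightarrow> ennreal" where
  "ball_profile r t = ennreal (sqrt (r\<^sup>2 - t\<^sup>2))"

lemma admissible_ball_profile: "admissible (ball_profile r)"
  unfolding admissible_def ball_profile_def by (auto intro!: ennreal_leI power_mono)

text \<open>The axis lies in the hyperplane orthogonal to any coordinate direction of the second
  factor. This disposes of the axis segment in the profile set of the ball.\<close>

lemma negligible_snd_eq_0: "negligible {x :: real \<times> (real^'m::finite). snd x = 0}"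
proof -
  obtain i :: 'm where True by simp
  have "negligible {x :: real \<times> (real^'m). (0, axis i 1) \<bullet> x = 0}"
    by (rule negligible_hyperplane) (simp add: zero_prod_def axis_eq_0_iff)
  then show ?thesis
    by (rule negligible_subset) (auto simp: inner_prod_def)
qed

lemma cball_subset_profile_set_ball_profile:
  assumes "r \<le> 1/4"
  shows "cball 0 r \<subseteq> (profile_set (ball_profile r) :: (real \<times> (real^'m::finite)) set)"
proof
  fix x :: "real \<times> (real^'m)" assume x: "x \<in> cball 0 r"
  obtain a b where ab: "x = (a, b)" by (cases x)
  have nx: "norm x \<le> r" using x by simp
  then have "(norm x)\<^sup>2 \<le> r\<^sup>2" by (intro power_mono) auto
  then have "norm b \<le> sqrt (r\<^sup>2 - a\<^sup>2)"
    by (intro real_le_rsqrt) (simp add: ab norm_Pair)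
  moreover have "\<bar>a\<bar> \<le> 1/2" using nx assms norm_fst_le[of a b] by (simp add: ab)
  ultimately show "x \<in> profile_set (ball_profile r)"
    by (auto simp: profile_set_def strip_def ab ball_profile_def intro!: ennreal_leI)
qed

lemma profile_set_ball_profile_subset:
  assumes "0 < r"
  shows "profile_set (ball_profile r) \<subseteq> cball 0 r \<union> {x :: real \<times> (real^'m::finite). snd x = 0}"
proof
  fix x :: "real \<times> (real^'m)" assume x: "x \<in> profile_set (ball_profile r)"
  obtain a b where ab: "x = (a, b)" by (cases x)
  have *: "ennreal (norm b) \<le> ennreal (sqrt (r\<^sup>2 - a\<^sup>2))"
    using x by (simp add: profile_set_def ab ball_profile_def)
  show "x \<in> cball 0 r \<union> {x. snd x = 0}"
  proof (cases "b = 0")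
    case False
    with * have le: "norm b \<le> sqrt (r\<^sup>2 - a\<^sup>2)" by (auto simp: ennreal_le_iff2)
    have "0 < norm b" using False by simp
    with le have "0 < sqrt (r\<^sup>2 - a\<^sup>2)" by linarith
    then have "0 \<le> r\<^sup>2 - a\<^sup>2" by simp
    moreover have "(norm b)\<^sup>2 \<le> (sqrt (r\<^sup>2 - a\<^sup>2))\<^sup>2" using le by (intro power_mono) auto
    ultimately have "sqrt (a\<^sup>2 + (norm b)\<^sup>2) \<le> r"
      using assms by (intro real_le_lsqrt) auto
    then show ?thesis by (simp add: ab norm_Pair)
  qed (simp add: ab)
qed

lemma emeasure_profile_set_ball_profile:
  assumes "0 < r" "r \<le> 1/4"
  shows "emeasure lebesgue (profile_set (ball_profile r) :: (real \<times> (real^'m::finite)) set)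
    = ennreal (unit_ball_vol (dimn TYPE('m)) * r powr dimn TYPE('m))"
proof -
  let ?F = "profile_set (ball_profile r) :: (real \<times> (real^'m)) set"
  define N where "N = ?F - cball 0 r"
  have "negligible N"
    using profile_set_ball_profile_subset[OF assms(1)] unfolding N_def
    by (intro negligible_subset[OF negligible_snd_eq_0]) auto
  then have N: "N \<in> null_sets lebesgue" by (simp add: negligible_iff_null_sets)
  have "?F = cball 0 r \<union> N"
    using cball_subset_profile_set_ball_profile[OF assms(2)] by (auto simp: N_def)
  then have "emeasure lebesgue ?F = emeasure lebesgue (cball (0 :: real \<times> (real^'m)) r)"
    using N by (simp add: emeasure_Un_null_set)
  also have "\<dots> = ennreal (unit_ball_vol (dimn TYPE('m)) * r powr dimn TYPE('m))"
    using assms unfolding dimn_eq_DIM by (simp only: powr_realpow) (simp add: emeasure_cball)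
  finally show ?thesis .
qed

text \<open>The inner integral is at most a multiple of \<open>(r - norm x) powr - s\<close>, a
  power of the distance to the sphere, which is integrable over the ball; the two constants
  multiply.\<close>

lemma PS_ball_profile_le:
  fixes r s :: real
  defines "n \<equiv> dimn TYPE('m::finite)"
  assumes "0 < r" "r \<le> 1/4" "0 < s" "s < 1"
  shows "PS s (profile_set (ball_profile r) :: (real \<times> (real^'m)) set)
    \<le> ennreal (2 * ((n + s) / s * unit_ball_vol n) * ((n * s / (1 - s) + 1) * unit_ball_vol n) * r powr (n - s))"
proof -
  let ?F = "profile_set (ball_profile r) :: (real \<times> (real^'m)) set"
  let ?c = "2 * ((n + s) / s * unit_ball_vol n)"
  have n: "n \<ge> 1" unfolding n_def dimn_def by simp
  then have c: "?c \<ge> 0" using assms by simp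
  have [measurable]: "ball (0 :: real \<times> (real^'m)) r \<in> sets borel" by simp
  \<comment> \<open>The pointwise bound needs \<open>norm x < r\<close>. The points of the profile
    set that violate it lie on the sphere or on the axis, hence in a null set.\<close>
  have "negligible (sphere 0 r \<union> {x :: real \<times> (real^'m). snd x = 0})"
    by (intro negligible_Un negligible_snd_eq_0 negligible_sphere)
  then have "AE x in lebesgue. x \<notin> sphere 0 r \<union> {x :: real \<times> (real^'m). snd x = 0}"
    by (intro AE_not_in) (simp add: negligible_iff_null_sets)
  then have AE: "AE x in lebesgue. x \<in> ?F \<longrightarrow> norm x < r"
    by (rule eventually_mono) (use profile_set_ball_profile_subset[OF assms(2), where 'm='m] in force)
  have "PS s ?F \<le> (\<integral>\<^sup>+ x. ennreal ?c * (ennreal ((r - norm x) powr - s) * indicator (ball 0 r) x)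
      \<partial>(lebesgue :: (real \<times> (real^'m)) measure))"
    unfolding PS_def
  proof (rule nn_integral_mono_AE, use AE in \<open>rule eventually_mono\<close>)
    fix x :: "real \<times> (real^'m)" assume x: "x \<in> ?F \<longrightarrow> norm x < r"
    show "(\<integral>\<^sup>+ y\<in>strip - ?F. Kern s (x - y) \<partial>lebesgue) * indicator (?F \<inter> strip) x
      \<le> ennreal ?c * (ennreal ((r - norm x) powr - s) * indicator (ball 0 r) x)"
    proof (cases "x \<in> ?F")
      case True
      then have xr: "norm x < r" using x by simp
      have "(\<integral>\<^sup>+ y\<in>strip - ?F. Kern s (x - y) \<partial>lebesgue) \<le> (\<integral>\<^sup>+ y\<in>strip - cball 0 r. Kern s (x - y) \<partial>lebesgue)"
        using cball_subset_profile_set_ball_profile[OF assms(3), where 'm='m]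
        by (intro nn_integral_mono mult_left_mono) (auto simp: indicator_def)
      also have "\<dots> \<le> ennreal (?c * (r - norm x) powr - s)"
        unfolding nn_integral_completion n_def
        using nn_integral_strip_Kern_le_dist[OF xr assms(3,4)] by simp
      also have "\<dots> = ennreal ?c * ennreal ((r - norm x) powr - s)"
        by (rule ennreal_mult'[OF c])
      finally have "(\<integral>\<^sup>+ y\<in>strip - ?F. Kern s (x - y) \<partial>lebesgue) \<le> ennreal ?c * ennreal ((r - norm x) powr - s)" .
      then show ?thesis
        using xr by (auto simp: indicator_def)
    qed simp
  qed
  also have "\<dots> = ennreal ?c * (\<integral>\<^sup>+ x\<in>ball 0 r. ennreal ((r - norm x) powr - s)
      \<partial>(lborel :: (real \<times> (real^'m)) measure))"
    unfolding nn_integral_completion by (rule nn_integral_cmult) measurable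
  also have "\<dots> \<le> ennreal ?c * ennreal ((n * s / (1 - s) + 1) * unit_ball_vol n * r powr (n - s))"
    unfolding n_def dimn_eq_DIM using assms by (intro mult_left_mono nn_integral_ball_dist_powr_le) auto
  also have "\<dots> = ennreal (?c * ((n * s / (1 - s) + 1) * unit_ball_vol n) * r powr (n - s))"
    using c n assms by (subst ennreal_mult[symmetric]) (auto simp: mult.assoc)
  finally show ?thesis .
qed

section \<open>Lower bound for the perimeter of a profile set\<close>

lemma PS_profile_set_ge:
  fixes R h s :: real and f :: "real \<Rightarrow> ennreal"
  defines "m \<equiv> CARD('m::finite)" and "n \<equiv> dimn TYPE('m)"
  assumes "admissible f" "f (1/8) \<le> ennreal R" "ennreal h \<le> f (1/4)" "0 < R" "R \<le> 1/4" "0 \<le> h" "0 < s"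
  shows "ennreal ((4 * R) powr - (n + s) * (R * (unit_ball_vol m * R ^ m)) * (1/8 * (unit_ball_vol m * h ^ m)))
    \<le> PS s (profile_set f :: (real \<times> (real^'m)) set)"
proof -
  let ?F = "profile_set f :: (real \<times> (real^'m)) set"
  let ?w = "unit_ball_vol (real m)"
  have w: "?w > 0" by simp
  have m: "m \<ge> 1" unfolding m_def by (simp add: Suc_leI)
  define Q where "Q = {1/8..1/4::real} \<times> cball (0 :: real^'m) h"
  have mono: "f b \<le> f a" if "0 \<le> a" "a \<le> b" "b \<le> 1/2" for a b
    using assms(3) that by (auto simp: admissible_def)
  have "ennreal h \<le> ennreal R"
    using assms(4,5) mono[of "1/8" "1/4"] by (auto intro: order_trans)
  then have hR: "h \<le> R" using \<open>0 < R\<close> by (simp add: ennreal_le_iff2)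
  define c where "c = (4 * R) powr - (n + s)"
  have QF: "Q \<subseteq> ?F \<inter> strip"
  proof
    fix x assume "x \<in> Q"
    then obtain a b where x: "x = (a, b)" "1/8 \<le> a" "a \<le> 1/4" "norm b \<le> h"
      by (auto simp: Q_def)
    have "ennreal (norm b) \<le> ennreal h" using x by (simp add: ennreal_leI)
    also have "\<dots> \<le> f (1/4)" by fact
    also have "\<dots> \<le> f a" using x by (intro mono) auto
    finally show "x \<in> ?F \<inter> strip"
      using x by (auto simp: profile_set_def strip_def)
  qed
  have inner: "ennreal (c * (R * (?w * R ^ m))) \<le> (\<integral>\<^sup>+ y\<in>strip - ?F. Kern s (x - y) \<partial>lebesgue)"
    if xQ: "x \<in> Q" for x
  proof -
    obtain a b where x: "x = (a, b)" "1/8 \<le> a" "a \<le> 1/4" "norm b \<le> h"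
      using xQ by (auto simp: Q_def)
    \<comment> \<open>The outer region is cut down to a box that moves with \<open>x\<close>. It
      stays in the strip since \<open>a \<le> 1/4\<close> and \<open>R \<le> 1/4\<close>, misses
      \<open>?F\<close> since \<open>f \<le> R\<close> beyond 1/8, and lies within
      \<open>R + (h + 2 * R) \<le> 4 * R\<close> of \<open>x\<close>.\<close>
    define D where "D = {a..a + R} \<times> (cball (0 :: real^'m) (2 * R) - cball 0 R)"
    have [measurable]: "D \<in> sets borel"
      unfolding D_def by (simp add: borel_Times)
    \<comment> \<open>The shell between radii \<open>R\<close> and \<open>2 * R\<close> has
      \<open>2 ^ m - 1\<close> times the volume of the inner ball, and this factor is at least
      1.\<close>
    have "R * (?w * R ^ m) \<le> R * (?w * (2 * R) ^ m - ?w * R ^ m)"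
    proof (intro mult_left_mono)
      have "(2::real) ^ 1 \<le> 2 ^ m" using m by (intro power_increasing) auto
      then have "2 * (?w * R ^ m) \<le> 2 ^ m * (?w * R ^ m)"
        using w \<open>0 < R\<close> by (intro mult_right_mono) auto
      then show "?w * R ^ m \<le> ?w * (2 * R) ^ m - ?w * R ^ m"
        by (simp add: power_mult_distrib algebra_simps)
    qed (use assms in simp)
    then have "ennreal (R * (?w * R ^ m)) \<le> ennreal (R * (?w * (2 * R) ^ m - ?w * R ^ m))"
      by (rule ennreal_leI)
    also have "\<dots> = ennreal R * (ennreal (?w * (2 * R) ^ m) - ennreal (?w * R ^ m))"
      using w \<open>0 < R\<close> by (subst ennreal_mult') (auto simp: ennreal_minus)
    also have "\<dots> = ennreal R * emeasure lborel (cball (0 :: real^'m) (2 * R) - cball 0 R)"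
      using \<open>0 < R\<close> by (subst emeasure_Diff) (auto simp: emeasure_cball m_def)
    also have "\<dots> = emeasure lborel D"
      unfolding D_def using \<open>0 < R\<close> by (subst emeasure_lborel_Times) auto
    finally have D: "ennreal (R * (?w * R ^ m)) \<le> emeasure lborel D" .
    have "ennreal (c * (R * (?w * R ^ m))) = ennreal c * ennreal (R * (?w * R ^ m))"
      by (simp add: c_def ennreal_mult')
    also have "\<dots> \<le> ennreal c * emeasure lborel D"
      using D by (intro mult_left_mono) auto
    also have "\<dots> = (\<integral>\<^sup>+ y\<in>D. ennreal c \<partial>lborel)"
      by (simp add: nn_integral_cmult_indicator)
    also have "\<dots> \<le> (\<integral>\<^sup>+ y\<in>strip - ?F. Kern s (x - y) \<partial>lborel)"
    proof (intro nn_integral_mono)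
      fix y
      show "ennreal c * indicator D y \<le> Kern s (x - y) * indicator (strip - ?F) y"
      proof (cases "y \<in> D")
        case True
        then obtain a' b' where y: "y = (a', b')" "a \<le> a'" "a' \<le> a + R" "norm b' \<le> 2 * R" "R < norm b'"
          by (auto simp: D_def)
        have "f a' \<le> f (1/8)"
          using x y assms by (intro mono) auto
        also have "\<dots> \<le> ennreal R" by fact
        also have "\<dots> < ennreal (norm b')"
          using y \<open>0 < R\<close> by (simp add: ennreal_less_iff)
        finally have yF: "y \<in> strip - ?F"
          using x y assms by (auto simp: profile_set_def strip_def not_le)
        have ne: "x - y \<noteq> 0" using x y hR by (auto simp: zero_prod_def)
        have "norm (x - y) \<le> norm (a - a') + norm (b - b')"
          using norm_Pair_le[of "a - a'" "b - b'"] by (simp add: x y)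
        also have "\<dots> \<le> R + (h + 2 * R)"
          using x y norm_triangle_ineq4[of b b'] by auto
        also have "\<dots> \<le> 4 * R" using hR by simp
        finally have "c \<le> norm (x - y) powr - (n + s)"
          unfolding c_def using ne assms by (intro powr_mono2') (auto simp: n_def dimn_def)
        then have "ennreal c \<le> ennreal (norm (x - y) powr - (n + s))" by (rule ennreal_leI)
        also have "\<dots> \<le> Kern s (x - y)"
          unfolding n_def by (rule Kern_ge[OF ne])
        finally show ?thesis using yF True by simp
      qed simp
    qed
    finally show ?thesis unfolding nn_integral_completion .
  qed
  have [measurable]: "Q \<in> sets borel"
    unfolding Q_def by (simp add: borel_Times)
  have "ennreal (c * (R * (?w * R ^ m)) * (1/8 * (?w * h ^ m))) =
      ennreal (c * (R * (?w * R ^ m))) * (ennreal (1/8) * ennreal (?w * h ^ m))"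
    using w assms by (simp add: c_def flip: ennreal_mult)
  also have "ennreal (1/8) * ennreal (?w * h ^ m) = emeasure lborel Q"
    unfolding Q_def using \<open>0 \<le> h\<close> by (subst emeasure_lborel_Times) (auto simp: emeasure_cball m_def)
  also have "ennreal (c * (R * (?w * R ^ m))) * emeasure lborel Q = (\<integral>\<^sup>+ x\<in>Q. ennreal (c * (R * (?w * R ^ m))) \<partial>lborel)"
    by (simp add: nn_integral_cmult_indicator)
  also have "\<dots> \<le> PS s ?F"
    unfolding PS_def nn_integral_completion
    using inner QF by (intro nn_integral_mono) (auto simp: indicator_def nn_integral_completion)
  finally show ?thesis unfolding c_def .
qed

section \<open>Volume constraint and height of the minimiser\<close>

lemma profile_cylinder_volume_le:
  fixes f :: "real \<Rightarrow> ennreal"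
  defines "m \<equiv> CARD('m::finite)"
  assumes "admissible f" "emeasure lebesgue (profile_set f :: (real \<times> (real^'m)) set) = ennreal \<mu>"
    and "0 < \<mu>" "0 < a" "a \<le> 1/2" "0 \<le> \<rho>" "ennreal \<rho> \<le> f a"
  shows "2 * a * (unit_ball_vol m * \<rho> ^ m) \<le> \<mu>"
proof -
  let ?F = "profile_set f :: (real \<times> (real^'m)) set"
  let ?Q = "{- a..a} \<times> cball (0 :: real^'m) \<rho>"
  \<comment> \<open>Since \<open>emeasure\<close> is 0 on non-measurable sets, the positive volume
    \<open>\<mu>\<close> yields measurability without any assumption of measurability on
    \<open>f\<close>.\<close>
  have F: "?F \<in> sets lebesgue"
    using assms by (intro emeasure_neq_0_sets) auto
  have "?Q \<subseteq> ?F"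
  proof
    fix x assume "x \<in> ?Q"
    then obtain t b where x: "x = (t, b)" "\<bar>t\<bar> \<le> a" "norm b \<le> \<rho>"
      by (auto simp: abs_le_iff)
    have "ennreal (norm b) \<le> ennreal \<rho>" using x by (simp add: ennreal_leI)
    also have "\<dots> \<le> f a" by fact
    also have "\<dots> \<le> f \<bar>t\<bar>" using assms x by (auto simp: admissible_def)
    also have "\<dots> = f t" using assms x by (auto simp: admissible_def abs_if)
    finally show "x \<in> ?F" using x assms by (auto simp: profile_set_def strip_def)
  qed
  have "ennreal (2 * a * (unit_ball_vol m * \<rho> ^ m)) = ennreal (2 * a) * ennreal (unit_ball_vol m * \<rho> ^ m)"
    using assms by (intro ennreal_mult') simp
  also have "\<dots> = emeasure lborel ?Q"
    using assms by (subst emeasure_lborel_Times) (auto simp: emeasure_cball)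
  also have "\<dots> = emeasure lebesgue ?Q"
    by (simp add: borel_Times)
  also have "\<dots> \<le> emeasure lebesgue ?F"
    by (rule emeasure_mono) fact+
  finally show ?thesis
    using assms by (simp add: ennreal_le_iff)
qed

text \<open>If \<open>f a\<close> exceeded \<open>R\<close>, some finite \<open>\<rho>\<close> would
  lie strictly between, and its cylinder would already have volume above \<open>\<mu>\<close>.
  Passing to \<open>\<rho>\<close> also covers \<open>f a\<close> infinite.\<close>

lemma profile_le_of_volume:
  fixes f :: "real \<Rightarrow> ennreal"
  defines "m \<equiv> CARD('m::finite)"
  assumes "admissible f" "emeasure lebesgue (profile_set f :: (real \<times> (real^'m)) set) = ennreal \<mu>"
    and "0 < \<mu>" "0 < a" "a \<le> 1/2" "0 \<le> R" "2 * a * (unit_ball_vol m * R ^ m) = \<mu>"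
  shows "f a \<le> ennreal R"
proof (rule ccontr)
  assume "\<not> f a \<le> ennreal R"
  then have "ennreal R < f a" by simp
  from dense[OF this] obtain z where z: "ennreal R < z" "z < f a"
    by blast
  then obtain \<rho> where \<rho>: "z = ennreal \<rho>" "0 \<le> \<rho>"
    by (cases z) auto
  have "R < \<rho>" using z \<rho> \<open>0 \<le> R\<close> by (simp add: ennreal_less_iff)
  then have "R ^ m < \<rho> ^ m"
    using \<open>0 \<le> R\<close> by (intro power_strict_mono) (auto simp: m_def)
  moreover have "2 * a * (unit_ball_vol m * \<rho> ^ m) \<le> 2 * a * (unit_ball_vol m * R ^ m)"
    unfolding assms(8) unfolding m_def
    using assms z \<rho> by (intro profile_cylinder_volume_le[where 'm='m and f=f]) auto
  ultimately show False
    using \<open>0 < a\<close> by (simp add: mult_le_cancel_left_pos)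
qed

text \<open>Comparing the minimiser with a ball of the same volume; for volumes bounded away from \<open>0\<close>
  the volume constraint alone suffices.\<close>

lemma minimizer_height_power_le:
  fixes s :: real
  defines "m \<equiv> CARD('m::finite)" and "n \<equiv> dimn TYPE('m)"
  assumes s: "0 < s" "s < 1"
  shows "\<exists>C>0. \<forall>(\<mu>::real) (f::real \<Rightarrow> ennreal). 0 < \<mu> \<longrightarrow> admissible f \<longrightarrow>
       emeasure lebesgue (profile_set f :: (real \<times> (real^'m)) set) = ennreal \<mu> \<longrightarrow>
       (\<forall>F \<in> (classK :: (real \<times> (real^'m)) set set). emeasure lebesgue F = ennreal \<mu> \<longrightarrow>
           PS s (profile_set f :: (real \<times> (real^'m)) set) \<le> PS s F) \<longrightarrow>
       (\<exists>h\<ge>0. f (1/4) = ennreal h \<and> h ^ m \<le> C * \<mu> powr (1 + s / n\<^sup>2))"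
proof -
  define w where "w = unit_ball_vol (real m)"
  define W where "W = unit_ball_vol n"
  have m: "m \<ge> 1" unfolding m_def by (simp add: Suc_leI)
  have n: "n = real m + 1" unfolding n_def m_def dimn_def by simp
  have w: "w > 0" and W: "W > 0" unfolding w_def W_def using n by auto
  define A where "A = 2 * ((n + s) / s * W) * ((n * s / (1 - s) + 1) * W)"
  have A: "A > 0" unfolding A_def using n s W by (intro mult_pos_pos add_pos_pos divide_pos_pos) auto
  \<comment> \<open>The numerical factor left in the perimeter lower bound once all powers of
    \<open>R\<close> and \<open>h\<close> are taken out; 1/8 is the length of
    \<open>[1/8, 1/4]\<close>.\<close>
  define c0 where "c0 = 4 powr - (n + s) * w * (1/8 * w)"
  have c0: "c0 > 0" unfolding c0_def using w by simp
  \<comment> \<open>The three entries ensure in turn that lowering an exponent of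
    \<open>\<mu>\<close> enlarges the power, that the ball radius \<open>r\<close> is at most 1/4,
    and that \<open>R \<le> 1/4\<close>.\<close>
  define \<mu>0 where "\<mu>0 = min 1 (min (W * (1/4) powr n) (w / 4 * (1/4) ^ m))"
  have \<mu>0: "\<mu>0 > 0" unfolding \<mu>0_def using w W by simp
  define C1 where "C1 = A / c0 * ((4 / w) powr (s / m) * (1 / W) powr ((n - s) / n))"
  define C2 where "C2 = 4 / w * \<mu>0 powr - (s / n\<^sup>2)"
  have C: "C1 > 0" "C2 > 0" unfolding C1_def C2_def using A c0 w W \<mu>0 by auto
  show ?thesis
  proof (rule exI[of _ "C1 + C2"], intro conjI allI impI)
    show "C1 + C2 > 0" using C by simp
    fix \<mu> :: real and f :: "real \<Rightarrow> ennreal"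
    let ?F = "profile_set f :: (real \<times> (real^'m)) set"
    assume \<mu>: "0 < \<mu>" and f: "admissible f" and vol: "emeasure lebesgue ?F = ennreal \<mu>"
      and mini: "\<forall>F \<in> (classK :: (real \<times> (real^'m)) set set). emeasure lebesgue F = ennreal \<mu> \<longrightarrow> PS s ?F \<le> PS s F"
    \<comment> \<open>Solves \<open>2 * (1/8) * (w * R ^ m) = \<mu>\<close>, the volume constraint
      at \<open>a = 1/8\<close>.\<close>
    define R where "R = (4 * \<mu> / w) powr (1 / m)"
    have R: "R > 0" unfolding R_def using \<mu> w by simp
    have Rm: "R ^ m = 4 * \<mu> / w"
      unfolding R_def using \<mu> w m by (simp add: powr_powr flip: powr_realpow)
    have f8: "f (1/8) \<le> ennreal R"
      using R \<mu> vol f w Rm by (intro profile_le_of_volume[where 'm='m and \<mu>=\<mu>]) (auto simp: w_def m_def)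
    have f48: "f (1/4) \<le> f (1/8)"
      using f unfolding admissible_def by auto
    obtain h where h: "f (1/4) = ennreal h" "h \<ge> 0"
      using f48 f8 by (cases "f (1/4)") (auto simp: top_unique)
    have hR: "h \<le> R"
      using order_trans[OF f48 f8] h R by (simp add: ennreal_le_iff2)
    have "h ^ m \<le> (C1 + C2) * \<mu> powr (1 + s / n\<^sup>2)"
    proof (cases "\<mu> \<le> \<mu>0")
      case False
      have "h ^ m \<le> R ^ m" using h hR by (intro power_mono) auto
      also have "\<dots> = 4 / w * \<mu> * 1" by (simp add: Rm)
      \<comment> \<open>The inserted factor is \<open>(\<mu> / \<mu>0) powr (s / n\<^sup>2)\<close>,
        at least 1 in this case; it supplies the missing power of \<open>\<mu>\<close>.\<close>
      also have "\<dots> \<le> 4 / w * \<mu> * (\<mu>0 powr - (s / n\<^sup>2) * \<mu> powr (s / n\<^sup>2))"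
      proof (rule mult_left_mono)
        have "1 = \<mu>0 powr - (s / n\<^sup>2) * \<mu>0 powr (s / n\<^sup>2)"
          using \<mu>0 by (simp flip: powr_add)
        also have "\<dots> \<le> \<mu>0 powr - (s / n\<^sup>2) * \<mu> powr (s / n\<^sup>2)"
          using \<mu>0 False s by (intro mult_left_mono powr_mono2) auto
        finally show "1 \<le> \<mu>0 powr - (s / n\<^sup>2) * \<mu> powr (s / n\<^sup>2)" .
      qed (use \<mu> w in simp)
      also have "\<dots> = C2 * \<mu> powr (1 + s / n\<^sup>2)"
        using \<mu> by (simp add: C2_def powr_add)
      also have "\<dots> \<le> (C1 + C2) * \<mu> powr (1 + s / n\<^sup>2)"
        using C by (intro mult_right_mono) auto
      finally show ?thesis .
    next
      case True
      then have small: "\<mu> \<le> 1" "\<mu> \<le> W * (1/4) powr n" "\<mu> \<le> w / 4 * (1/4) ^ m"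
        by (auto simp: \<mu>0_def)
      have R4: "R \<le> 1/4"
      proof (rule power_le_imp_le_base[of R "m - 1"])
        show "R ^ Suc (m - 1) \<le> (1/4) ^ Suc (m - 1)"
          using m small(3) w by (simp add: Rm field_simps)
      qed simp
      define r where "r = (\<mu> / W) powr (1 / n)"
      have r: "r > 0" unfolding r_def using \<mu> W by simp
      have rn: "r powr n = \<mu> / W" unfolding r_def using \<mu> W n by (simp add: powr_powr)
      have r4: "r \<le> 1/4"
      proof (rule ccontr)
        assume "\<not> r \<le> 1/4"
        then have "(1/4) powr n < r powr n" using n by (intro powr_less_mono2) auto
        then show False using small(2) W by (simp add: rn field_simps)
      qed
      have "emeasure lebesgue (profile_set (ball_profile r) :: (real \<times> (real^'m)) set) = ennreal \<mu>"
        using emeasure_profile_set_ball_profile[OF r r4, where 'm='m] rn W by (simp add: n_def W_def)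
      moreover have "profile_set (ball_profile r) \<in> (classK :: (real \<times> (real^'m)) set set)"
        unfolding classK_def using admissible_ball_profile by auto
      ultimately have "PS s ?F \<le> PS s (profile_set (ball_profile r) :: (real \<times> (real^'m)) set)"
        using mini by blast
      also have "\<dots> \<le> ennreal (A * r powr (n - s))"
        unfolding A_def W_def n_def by (rule PS_ball_profile_le[OF r r4 s])
      finally have "PS s ?F \<le> ennreal (A * r powr (n - s))" .
      moreover have "ennreal ((4 * R) powr - (n + s) * (R * (w * R ^ m)) * (1/8 * (w * h ^ m))) \<le> PS s ?F"
        unfolding w_def m_def n_def using f f8 h R R4 s by (intro PS_profile_set_ge) auto
      ultimately have "ennreal ((4 * R) powr - (n + s) * (R * (w * R ^ m)) * (1/8 * (w * h ^ m))) \<le> ennreal (A * r powr (n - s))"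
        by (rule order_trans[rotated])
      then have "(4 * R) powr - (n + s) * (R * (w * R ^ m)) * (1/8 * (w * h ^ m)) \<le> A * r powr (n - s)"
        using A by (simp add: ennreal_le_iff)
      also have "(4 * R) powr - (n + s) * (R * (w * R ^ m)) * (1/8 * (w * h ^ m))
        = c0 * (R powr - (n + s) * R powr 1 * R powr m) * h ^ m"
        using R by (simp add: c0_def powr_mult powr_realpow)
      \<comment> \<open>The exponents add up to \<open>- s\<close> because
        \<open>n = m + 1\<close>.\<close>
      also have "R powr - (n + s) * R powr 1 * R powr m = R powr - s"
        unfolding n by (simp only: flip: powr_add) simp
      finally have "c0 * R powr - s * h ^ m \<le> A * r powr (n - s)" .
      then have "h ^ m \<le> A / c0 * (R powr s * r powr (n - s))"
        using c0 R by (simp add: powr_minus field_simps)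
      also have "R powr s = (4 / w) powr (s / m) * \<mu> powr (s / m)"
        unfolding R_def using \<mu> w by (simp add: powr_powr flip: powr_mult)
      also have "r powr (n - s) = (1 / W) powr ((n - s) / n) * \<mu> powr ((n - s) / n)"
        unfolding r_def using \<mu> W by (simp add: powr_powr flip: powr_mult)
      also have "A / c0 * ((4 / w) powr (s / m) * \<mu> powr (s / m) * ((1 / W) powr ((n - s) / n) * \<mu> powr ((n - s) / n)))
        = C1 * \<mu> powr (s / m + (n - s) / n)"
        by (simp add: C1_def powr_add)
      \<comment> \<open>The exponent on the left equals \<open>1 + s / (m * n)\<close>, which is at
        least \<open>1 + s / n\<^sup>2\<close> since \<open>m \<le> n\<close>; with
        \<open>\<mu> \<le> 1\<close> the smaller exponent gives the larger power.\<close>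
      also have "\<dots> \<le> C1 * \<mu> powr (1 + s / n\<^sup>2)"
      proof (intro mult_left_mono powr_mono')
        have m0: "0 < real m" using m by simp
        have "s / n\<^sup>2 \<le> s / (m * n)"
          using s n m0 by (intro divide_left_mono) (auto simp: power2_eq_square)
        also have "\<dots> = s / m - s / n"
          using m0 n by (simp add: field_simps)
        finally show "1 + s / n\<^sup>2 \<le> s / m + (n - s) / n"
          using n m0 by (simp add: diff_divide_distrib)
      qed (use C small \<mu> in auto)
      also have "\<dots> \<le> (C1 + C2) * \<mu> powr (1 + s / n\<^sup>2)"
        using C by (intro mult_right_mono) auto
      finally show ?thesis .
    qed
    then show "\<exists>h\<ge>0. f (1/4) = ennreal h \<and> h ^ m \<le> (C1 + C2) * \<mu> powr (1 + s / n\<^sup>2)"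
      using h by blast
  qed
qed

text \<open>Evenness and monotonicity give \<open>f \<le> h\<close> wherever the first coordinate
  has modulus at least 1/4. The cylinder used is taken over the whole interval of length 1, so no
  factor depends on the cut.\<close>

lemma profile_outer_volume_le:
  fixes f :: "real \<Rightarrow> ennreal"
  defines "m \<equiv> CARD('m::finite)"
  assumes "admissible f" "f (1/4) = ennreal h" "0 \<le> h"
  shows "emeasure lebesgue ((profile_set f :: (real \<times> (real^'m)) set) \<inter> {x. \<bar>fst x\<bar> \<ge> 1/4})
    \<le> ennreal (unit_ball_vol m * h ^ m)"
proof -
  let ?Q = "{- (1/2)..1/2::real} \<times> cball (0 :: real^'m) h"
  have "(profile_set f :: (real \<times> (real^'m)) set) \<inter> {x. \<bar>fst x\<bar> \<ge> 1/4} \<subseteq> ?Q"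
  proof
    fix x assume x: "x \<in> (profile_set f :: (real \<times> (real^'m)) set) \<inter> {x. \<bar>fst x\<bar> \<ge> 1/4}"
    obtain t b where tb: "x = (t, b)" by (cases x)
    have t: "1/4 \<le> \<bar>t\<bar>" "\<bar>t\<bar> \<le> 1/2" and b: "ennreal (norm b) \<le> f t"
      using x by (auto simp: tb profile_set_def strip_def)
    note b
    also have "f t = f \<bar>t\<bar>" using assms t by (auto simp: admissible_def abs_if)
    also have "\<dots> \<le> f (1/4)"
      using assms(2) t unfolding admissible_def by (metis zero_le_divide_1_iff zero_le_numeral)
    finally have "norm b \<le> h" using assms by (simp add: ennreal_le_iff)
    then show "x \<in> ?Q" using t by (auto simp: tb)
  qed
  then have "emeasure lebesgue ((profile_set f :: (real \<times> (real^'m)) set) \<inter> {x. \<bar>fst x\<bar> \<ge> 1/4}) \<le> emeasure lebesgue ?Q"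
    by (rule emeasure_mono) (simp add: borel_Times)
  also have "\<dots> = emeasure lborel ?Q"
    by (simp add: borel_Times)
  also have "\<dots> = ennreal (unit_ball_vol m * h ^ m)"
    using assms by (subst emeasure_lborel_Times) (auto simp: emeasure_cball)
  finally show ?thesis .
qed

section \<open>Deducing both estimates from the height bound\<close>

theorem theorem1p2:
  fixes s :: real
  assumes "0 < s" "s < 1"
  shows "\<exists>C>1.
    (\<forall>(\<mu>::real) (f::real \<Rightarrow> ennreal). 0 < \<mu> \<longrightarrow> admissible f \<longrightarrow>
       emeasure lebesgue (profile_set f :: (real \<times> (real^'m::finite)) set) = ennreal \<mu> \<longrightarrow>
       (\<forall>F \<in> (classK :: (real \<times> (real^'m)) set set). emeasure lebesgue F = ennreal \<mu> \<longrightarrow>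
           PS s (profile_set f :: (real \<times> (real^'m)) set) \<le> PS s F) \<longrightarrow>
       f (1/4) / ennreal (\<mu> powr (1 / (dimn TYPE('m) - 1)))
         \<le> ennreal (C * \<mu> powr (s / ((dimn TYPE('m))\<^sup>2 * (dimn TYPE('m) - 1))))) \<and>
    (\<forall>(\<delta>::real) (\<mu>::real) (f::real \<Rightarrow> ennreal). 0 < \<delta> \<longrightarrow> \<delta> < 1 \<longrightarrow>
       0 < \<mu> \<longrightarrow> \<mu> < inverse C * \<delta> powr ((dimn TYPE('m))\<^sup>2 / s) \<longrightarrow> admissible f \<longrightarrow>
       emeasure lebesgue (profile_set f :: (real \<times> (real^'m)) set) = ennreal \<mu> \<longrightarrow>
       (\<forall>F \<in> (classK :: (real \<times> (real^'m)) set set). emeasure lebesgue F = ennreal \<mu> \<longrightarrow>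
           PS s (profile_set f :: (real \<times> (real^'m)) set) \<le> PS s F) \<longrightarrow>
       emeasure lebesgue ((profile_set f :: (real \<times> (real^'m)) set) \<inter> {x. \<bar>fst x\<bar> \<ge> 1/4})
         \<le> ennreal \<delta> * emeasure lebesgue (profile_set f :: (real \<times> (real^'m)) set))"
proof -
  define m where "m = CARD('m)"
  define n where "n = dimn TYPE('m)"
  define w where "w = unit_ball_vol (real m)"
  have m: "m \<ge> 1" unfolding m_def by (simp add: Suc_leI)
  have n: "n = real m + 1" unfolding n_def m_def dimn_def by simp
  have w: "w > 0" unfolding w_def by simp
  define minimizer where "minimizer \<mu> f \<longleftrightarrow> 0 < \<mu> \<and> admissible f \<and>
       emeasure lebesgue (profile_set f :: (real \<times> (real^'m)) set) = ennreal \<mu> \<and>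
       (\<forall>F \<in> (classK :: (real \<times> (real^'m)) set set). emeasure lebesgue F = ennreal \<mu> \<longrightarrow>
           PS s (profile_set f :: (real \<times> (real^'m)) set) \<le> PS s F)" for \<mu> f
  obtain C1 where C1: "C1 > 0" and
    "\<forall>\<mu> f. minimizer \<mu> f \<longrightarrow> (\<exists>h\<ge>0. f (1/4) = ennreal h \<and> h ^ m \<le> C1 * \<mu> powr (1 + s / n\<^sup>2))"
    using minimizer_height_power_le[OF assms, where 'm='m] unfolding minimizer_def m_def n_def by metis
  then have height: "\<exists>h\<ge>0. f (1/4) = ennreal h \<and> h ^ m \<le> C1 * \<mu> powr (1 + s / n\<^sup>2)" if "minimizer \<mu> f" for \<mu> f
    using that by blast
  \<comment> \<open>The summand 2 gives \<open>C > 1\<close>, the second is the constant after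
    taking an \<open>m\<close>-th root, and the third turns the smallness of \<open>\<mu>\<close>
    into \<open>w * C1 * \<mu> powr (s / n\<^sup>2) \<le> \<delta>\<close>.\<close>
  define C where "C = 2 + C1 powr (1 / m) + (w * C1) powr (n\<^sup>2 / s)"
  have C: "C > 1" "C1 powr (1 / m) \<le> C" "(w * C1) powr (n\<^sup>2 / s) \<le> C"
    unfolding C_def by (auto intro: add_pos_nonneg simp: add_nonneg_nonneg)
  have part1: "f (1/4) / ennreal (\<mu> powr (1 / (n - 1))) \<le> ennreal (C * \<mu> powr (s / (n\<^sup>2 * (n - 1))))"
    if min: "minimizer \<mu> f" for \<mu> f
  proof -
    have \<mu>: "\<mu> > 0" using min by (simp add: minimizer_def)
    obtain h where h: "h \<ge> 0" "f (1/4) = ennreal h" "h ^ m \<le> C1 * \<mu> powr (1 + s / n\<^sup>2)"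
      using height[OF min] by blast
    have "h = (h ^ m) powr (1 / m)"
    proof (cases "h = 0")
      case False
      then show ?thesis using h m by (simp add: powr_powr flip: powr_realpow)
    qed (use m in simp)
    also have "\<dots> \<le> (C1 * \<mu> powr (1 + s / n\<^sup>2)) powr (1 / m)"
      using h by (intro powr_mono2) auto
    also have "\<dots> = C1 powr (1 / m) * \<mu> powr (1 / m + s / (n\<^sup>2 * m))"
      using C1 \<mu> by (simp add: powr_mult powr_powr add_divide_distrib)
    also have "\<dots> \<le> C * \<mu> powr (1 / m + s / (n\<^sup>2 * m))"
      using C by (intro mult_right_mono) auto
    also have "\<dots> = C * \<mu> powr (s / (n\<^sup>2 * m)) * \<mu> powr (1 / m)"
      by (simp add: powr_add)
    finally have "h / \<mu> powr (1 / m) \<le> C * \<mu> powr (s / (n\<^sup>2 * m))"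
      using \<mu> by (simp add: pos_divide_le_eq)
    then have "ennreal (h / \<mu> powr (1 / m)) \<le> ennreal (C * \<mu> powr (s / (n\<^sup>2 * m)))"
      by (rule ennreal_leI)
    moreover have "ennreal (h / \<mu> powr (1 / m)) = f (1/4) / ennreal (\<mu> powr (1 / m))"
      using h \<mu> by (simp add: divide_ennreal)
    ultimately show ?thesis by (simp add: n)
  qed
  have part2: "emeasure lebesgue ((profile_set f :: (real \<times> (real^'m)) set) \<inter> {x. \<bar>fst x\<bar> \<ge> 1/4}) \<le> ennreal \<delta> * ennreal \<mu>"
    if min: "minimizer \<mu> f" and \<delta>: "0 < \<delta>" "\<mu> < inverse C * \<delta> powr (n\<^sup>2 / s)" for \<mu> \<delta> f
  proof -
    have \<mu>: "\<mu> > 0" and f: "admissible f" using min by (auto simp: minimizer_def)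
    obtain h where h: "h \<ge> 0" "f (1/4) = ennreal h" "h ^ m \<le> C1 * \<mu> powr (1 + s / n\<^sup>2)"
      using height[OF min] by blast
    have n0: "n \<noteq> 0" using n by simp
    \<comment> \<open>The smallness condition is kept in its \<open>n\<^sup>2 / s\<close> form and
      then raised to the power \<open>s / n\<^sup>2\<close>, which undoes the exponents of both
      \<open>w * C1\<close> and \<open>\<delta>\<close>.\<close>
    have "(w * C1) powr (n\<^sup>2 / s) * \<mu> \<le> C * \<mu>"
      using C \<mu> by (intro mult_right_mono) auto
    also have "\<dots> \<le> \<delta> powr (n\<^sup>2 / s)"
      using \<delta> C by (simp add: field_simps)
    finally have "((w * C1) powr (n\<^sup>2 / s) * \<mu>) powr (s / n\<^sup>2) \<le> (\<delta> powr (n\<^sup>2 / s)) powr (s / n\<^sup>2)"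
      using \<mu> assms by (intro powr_mono2) auto
    then have key: "w * C1 * \<mu> powr (s / n\<^sup>2) \<le> \<delta>"
      using \<mu> \<delta> w C1 n0 assms by (simp add: powr_mult powr_powr)
    have "emeasure lebesgue ((profile_set f :: (real \<times> (real^'m)) set) \<inter> {x. \<bar>fst x\<bar> \<ge> 1/4}) \<le> ennreal (w * h ^ m)"
      unfolding w_def m_def by (rule profile_outer_volume_le[OF f h(2,1)])
    also have "w * h ^ m \<le> w * (C1 * \<mu> powr (1 + s / n\<^sup>2))"
      using w h by (intro mult_left_mono) auto
    also have "\<dots> = (w * C1 * \<mu> powr (s / n\<^sup>2)) * \<mu>"
      using \<mu> by (simp add: powr_add)
    also have "\<dots> \<le> \<delta> * \<mu>"
      using key \<mu> by (intro mult_right_mono) auto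
    also have "ennreal (\<delta> * \<mu>) = ennreal \<delta> * ennreal \<mu>"
      using \<delta> by (simp add: ennreal_mult')
    finally show ?thesis
      by (simp add: ennreal_leI)
  qed
  show ?thesis
  proof (intro exI[of _ C] conjI allI impI)
    show "C > 1" by fact
  next
    fix \<mu> :: real and f :: "real \<Rightarrow> ennreal"
    assume "0 < \<mu>" "admissible f"
       "emeasure lebesgue (profile_set f :: (real \<times> (real^'m)) set) = ennreal \<mu>"
       "\<forall>F \<in> (classK :: (real \<times> (real^'m)) set set). emeasure lebesgue F = ennreal \<mu> \<longrightarrow>
           PS s (profile_set f :: (real \<times> (real^'m)) set) \<le> PS s F"
    then have "minimizer \<mu> f" by (simp add: minimizer_def)
    from part1[OF this]
    show "f (1/4) / ennreal (\<mu> powr (1 / (dimn TYPE('m) - 1)))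
         \<le> ennreal (C * \<mu> powr (s / ((dimn TYPE('m))\<^sup>2 * (dimn TYPE('m) - 1))))"
      unfolding n_def .
  next
    fix \<delta> \<mu> :: real and f :: "real \<Rightarrow> ennreal"
    assume "0 < \<delta>" "\<delta> < 1" "0 < \<mu>" "\<mu> < inverse C * \<delta> powr ((dimn TYPE('m))\<^sup>2 / s)" "admissible f"
      and vol: "emeasure lebesgue (profile_set f :: (real \<times> (real^'m)) set) = ennreal \<mu>"
      and "\<forall>F \<in> (classK :: (real \<times> (real^'m)) set set). emeasure lebesgue F = ennreal \<mu> \<longrightarrow>
           PS s (profile_set f :: (real \<times> (real^'m)) set) \<le> PS s F"
    then have "minimizer \<mu> f" "0 < \<delta>" "\<mu> < inverse C * \<delta> powr (n\<^sup>2 / s)"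
      by (simp_all add: minimizer_def n_def)
    from part2[OF this]
    show "emeasure lebesgue ((profile_set f :: (real \<times> (real^'m)) set) \<inter> {x. \<bar>fst x\<bar> \<ge> 1/4})
         \<le> ennreal \<delta> * emeasure lebesgue (profile_set f :: (real \<times> (real^'m)) set)"
      unfolding vol .
  qed
qed

end
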